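(* Let $J$ be a finite set of jobs and $M$ a finite set of machines, and let $(\bar{x},\bar{y})$ be a feasible solution of the position-based formulation $\mathcal{M}'$ (the reference solution). Let $N(\bar{x},\bar{y})$ be the set consisting of (i) $(\bar{x},\bar{y})$ itself, (ii) all solutions obtained from $(\bar{x},\bar{y})$ by a single internal swap of two distinct jobs assigned to the same machine in $(\bar{x},\bar{y})$, and (iii) all solutions obtained from $(\bar{x},\bar{y})$ by a single starting-job shift from a machine $m$ to a machine $m'\neq m$. Then $N(\bar{x},\bar{y})$ coincides with the $4$-OPT neighbourhood of $(\bar{x},\bar{y})$; equivalently, a feasible solution $(x,y)$ of $\mathcal{M}'$ belongs to $N(\bar{x},\bar{y})$ if and only if $$\sum_{m\in M}\ \sum_{j\in J:\,\bar{y}_{jm}=1}(1-y_{jm})\;+\;\sum_{m\in M}\ \sum_{(i,j):\,\bar{x}_{ijm}=1}(1-x_{ijm})\;\le\; 2 .$$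
   Context: Jobs $J$ are to be assigned to and sequenced on parallel machines $M$. Each machine has $|J|$ slots, numbered $1,\dots,|J|$. A solution of the formulation $\mathcal{M}'$ is regarded as a pair of binary vectors $(x,y)$, where $x_{ijm}\in\{0,1\}$ equals $1$ iff job $j\in J$ occupies slot $i\in\{1,\dots,|J|\}$ of machine $m\in M$, and $y_{jm}\in\{0,1\}$ equals $1$ iff job $j$ is assigned to machine $m$. The pair is feasible iff: (a) $\sum_{i}\sum_{m\in M}x_{ijm}=1$ for every $j\in J$ (each job is in exactly one slot of one machine); (b) $\sum_{j\in J}x_{ijm}\le 1$ for every slot $i$ and every $m\in M$; (c) $\sum_{j\in J}x_{ijm}\ge\sum_{j\in J}x_{(i-1)jm}$ for every $i\in\{2,\dots,|J|\}$ and $m\in M$ (on each machine, all empty slots come first); (d) $y_{jm}=\sum_{i}x_{ijm}$ for every $j\in J$, $m\in M$. (The full formulation also has continuous variables for the processing, setup and completion times of slots. The constraints on them only define these times and do not restrict the feasible pairs $(x,y)$.) $k$-OPT neighbourhood: for a feasible reference solution $(\bar{x},\bar{y})$, this is the set of all feasible $(x,y)$ that differ from $(\bar{x},\bar{y})$ in at most $k$ binary coordinates, counting the coordinates of both $x$ and $y$. Since the total of all $x$-entries and the total of all $y$-entries each equal $|J|$ in every feasible solution, this condition is the local branching constraint $\sum_{m}\sum_{j:\bar{y}_{jm}=1}(1-y_{jm})+\sum_{m}\sum_{(i,j):\bar{x}_{ijm}=1}(1-x_{ijm})\le k/2$. Internal swap: two distinct jobs $j,j'$ occupying slots $i,i'$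 of the same machine $m$ exchange their slots (so $j$ occupies slot $i'$ and $j'$ occupies slot $i$ of $m$). All other jobs stay in their slots. Starting-job shift: for machines $m\ne m'$ with $m$ non-empty, the starting job of $m$ (the job in the first occupied slot of $m$) is removed from $m$ and becomes the starting job of $m'$. That is, it is placed in the slot of $m'$ immediately preceding the first occupied slot of $m'$, or in the last slot $|J|$ if $m'$ is empty. All other jobs stay in their slots. *)

theory Defs
  imports Main "HOL-Library.FuncSet"
begin

text \<open>
  Binary vectors are extensional functions on their index set, so that equality of two vectors
  means equality of all their coordinates. The coordinate \<open>x\<^sub>i\<^sub>j\<^sub>m\<close> is \<open>x (i, j, m)\<close>,
  where \<open>i\<close> is a slot, \<open>j\<close> a job and \<open>m\<close> a machine.
\<close>

type_synonym ('j, 'm) xvec = "nat \<times> 'j \<times> 'm \<Rightarrow> int"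
type_synonym ('j, 'm) yvec = "'j \<times> 'm \<Rightarrow> int"
type_synonym ('j, 'm) solution = "('j, 'm) xvec \<times> ('j, 'm) yvec"

definition slots :: "'j set \<Rightarrow> nat set" where
  "slots J = {1..card J}"

definition x_index :: "'j set \<Rightarrow> 'm set \<Rightarrow> (nat \<times> 'j \<times> 'm) set" where
  "x_index J M = slots J \<times> J \<times> M"

definition y_index :: "'j set \<Rightarrow> 'm set \<Rightarrow> ('j \<times> 'm) set" where
  "y_index J M = J \<times> M"

text \<open>
  The continuous time variables of the full formulation are left out: the constraints on them
  do not restrict the feasible pairs of binary vectors.
\<close>

definition feasible :: "'j set \<Rightarrow> 'm set \<Rightarrow> ('j, 'm) solution \<Rightarrow> bool" where
  "feasible J M = (\<lambda>(x, y).
     x \<in> x_index J M \<rightarrow>\<^sub>E {0, 1} \<and>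
     y \<in> y_index J M \<rightarrow>\<^sub>E {0, 1} \<and>
     (\<forall>j\<in>J. (\<Sum>i\<in>slots J. \<Sum>m\<in>M. x (i, j, m)) = 1) \<and>
     (\<forall>i\<in>slots J. \<forall>m\<in>M. (\<Sum>j\<in>J. x (i, j, m)) \<le> 1) \<and>
     (\<forall>i\<in>{2..card J}. \<forall>m\<in>M. (\<Sum>j\<in>J. x (i, j, m)) \<ge> (\<Sum>j\<in>J. x (i - 1, j, m))) \<and>
     (\<forall>j\<in>J. \<forall>m\<in>M. y (j, m) = (\<Sum>i\<in>slots J. x (i, j, m))))"

definition k_opt_neighbourhood ::
    "'j set \<Rightarrow> 'm set \<Rightarrow> nat \<Rightarrow> ('j, 'm) solution \<Rightarrow> ('j, 'm) solution set" where
  "k_opt_neighbourhood J M k = (\<lambda>(x0, y0).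
     {(x, y). feasible J M (x, y) \<and>
        card {t \<in> x_index J M. x t \<noteq> x0 t} + card {t \<in> y_index J M. y t \<noteq> y0 t} \<le> k})"

definition local_branching_lhs ::
    "'j set \<Rightarrow> 'm set \<Rightarrow> ('j, 'm) solution \<Rightarrow> ('j, 'm) solution \<Rightarrow> int" where
  "local_branching_lhs J M = (\<lambda>(x0, y0) (x, y).
     (\<Sum>m\<in>M. \<Sum>j\<in>{j \<in> J. y0 (j, m) = 1}. 1 - y (j, m)) +
     (\<Sum>m\<in>M. \<Sum>(i, j)\<in>{(i, j). i \<in> slots J \<and> j \<in> J \<and> x0 (i, j, m) = 1}. 1 - x (i, j, m)))"

definition occupied_slots :: "'j set \<Rightarrow> ('j, 'm) xvec \<Rightarrow> 'm \<Rightarrow> nat set" where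
  "occupied_slots J x m = {i \<in> slots J. \<exists>j\<in>J. x (i, j, m) = 1}"

definition internal_swap ::
    "'j set \<Rightarrow> 'm set \<Rightarrow> ('j, 'm) solution \<Rightarrow> ('j, 'm) solution \<Rightarrow> bool" where
  "internal_swap J M = (\<lambda>(x0, y0) (x, y).
     \<exists>m\<in>M. \<exists>j\<in>J. \<exists>j'\<in>J. \<exists>i\<in>slots J. \<exists>i'\<in>slots J.
       j \<noteq> j' \<and> x0 (i, j, m) = 1 \<and> x0 (i', j', m) = 1 \<and>
       x = x0((i, j, m) := 0, (i', j', m) := 0, (i', j, m) := 1, (i, j', m) := 1) \<and>
       y = y0)"

text \<open>
  The slot that a new starting job of a machine would take. In a feasible solution the
  subtraction yields a slot unless the machine contains all jobs; in that case every other
  machine is empty and there is no shift to it.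
\<close>

definition new_start_slot :: "'j set \<Rightarrow> ('j, 'm) xvec \<Rightarrow> 'm \<Rightarrow> nat" where
  "new_start_slot J x m =
     (if occupied_slots J x m = {} then card J else Min (occupied_slots J x m) - 1)"

definition starting_job_shift ::
    "'j set \<Rightarrow> 'm set \<Rightarrow> ('j, 'm) solution \<Rightarrow> ('j, 'm) solution \<Rightarrow> bool" where
  "starting_job_shift J M = (\<lambda>(x0, y0) (x, y).
     \<exists>m\<in>M. \<exists>m'\<in>M. \<exists>j\<in>J. \<exists>i.
       m \<noteq> m' \<and> occupied_slots J x0 m \<noteq> {} \<and>
       i = Min (occupied_slots J x0 m) \<and> x0 (i, j, m) = 1 \<and>
       x = x0((i, j, m) := 0, (new_start_slot J x0 m', j, m') := 1) \<and>
       y = y0((j, m) := 0, (j, m') := 1))"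

definition swap_shift_neighbourhood ::
    "'j set \<Rightarrow> 'm set \<Rightarrow> ('j, 'm) solution \<Rightarrow> ('j, 'm) solution set" where
  "swap_shift_neighbourhood J M s0 =
     {s0} \<union> {s. internal_swap J M s0 s} \<union> {s. starting_job_shift J M s0 s}"

end

theory Submission
  imports Defs
begin

text \<open>
  A feasible solution is the same thing as an injective placement of the jobs in pairs (slot, machine)
  such that the slots used on each machine form a final segment of the slots. So the number of jobs on
  a machine determines which slots are occupied. The left-hand side of the local branching constraint
  is the number of jobs that change position plus the number of jobs that change machine. If it is at
  most 2, then either no job changes machine, all occupied positions are kept and at most two jobs are
  permuted, or a single job moves to another machine; the final segments then force it to leave the
  first occupied slot and to enter the last free one.
\<close>

section \<open>Placements of jobs as encodings of binary vectors\<close>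

definition position_vec :: "'j set \<Rightarrow> 'm set \<Rightarrow> ('j \<Rightarrow> nat \<times> 'm) \<Rightarrow> ('j, 'm) xvec" where
  "position_vec J M p = (\<lambda>(i, j, m) \<in> x_index J M. of_bool (p j = (i, m)))"

definition machine_vec :: "'j set \<Rightarrow> 'm set \<Rightarrow> ('j \<Rightarrow> nat \<times> 'm) \<Rightarrow> ('j, 'm) yvec" where
  "machine_vec J M p = (\<lambda>(j, m) \<in> y_index J M. of_bool (snd (p j) = m))"

definition encode :: "'j set \<Rightarrow> 'm set \<Rightarrow> ('j \<Rightarrow> nat \<times> 'm) \<Rightarrow> ('j, 'm) solution" where
  "encode J M p = (position_vec J M p, machine_vec J M p)"

text \<open>Injectivity stands for constraint (b) and the last condition for (c); constraints (a)
  and (d) are built into \<open>encode\<close>. Values outside \<open>J\<close> are left free, so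
  that function updates need no restriction afterwards; hence one solution can come from several
  placements.\<close>

definition schedule :: "'j set \<Rightarrow> 'm set \<Rightarrow> ('j \<Rightarrow> nat \<times> 'm) \<Rightarrow> bool" where
  "schedule J M p \<longleftrightarrow> p \<in> J \<rightarrow> slots J \<times> M \<and> inj_on p J \<and>
     (\<forall>m\<in>M. \<forall>i\<in>{2..card J}. (i - 1, m) \<in> p ` J \<longrightarrow> (i, m) \<in> p ` J)"

definition load :: "'j set \<Rightarrow> ('j \<Rightarrow> nat \<times> 'm) \<Rightarrow> 'm \<Rightarrow> nat" where
  "load J p m = card {j \<in> J. snd (p j) = m}"

definition moved_jobs :: "'j set \<Rightarrow> ('j \<Rightarrow> nat \<times> 'm) \<Rightarrow> ('j \<Rightarrow> nat \<times> 'm) \<Rightarrow> 'j set" where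
  "moved_jobs J p q = {j \<in> J. p j \<noteq> q j}"

definition reassigned_jobs :: "'j set \<Rightarrow> ('j \<Rightarrow> nat \<times> 'm) \<Rightarrow> ('j \<Rightarrow> nat \<times> 'm) \<Rightarrow> 'j set" where
  "reassigned_jobs J p q = {j \<in> J. snd (p j) \<noteq> snd (q j)}"

lemma finite_slots [simp]: "finite (slots J)"
  by (simp add: slots_def)

lemma position_vec_apply [simp]:
  "i \<in> slots J \<Longrightarrow> j \<in> J \<Longrightarrow> m \<in> M \<Longrightarrow> position_vec J M p (i, j, m) = of_bool (p j = (i, m))"
  by (simp add: position_vec_def x_index_def)

lemma machine_vec_apply [simp]:
  "j \<in> J \<Longrightarrow> m \<in> M \<Longrightarrow> machine_vec J M p (j, m) = of_bool (snd (p j) = m)"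
  by (simp add: machine_vec_def y_index_def)

lemma placement_coords:
  assumes "p \<in> J \<rightarrow> slots J \<times> M" "j \<in> J" "p j = (i, m)"
  shows "i \<in> slots J" "m \<in> M"
  using Pi_mem[OF assms(1,2)] assms(3) by auto

lemma encode_cong: "(\<And>j. j \<in> J \<Longrightarrow> p j = q j) \<Longrightarrow> encode J M p = encode J M q"
  by (auto simp: encode_def position_vec_def machine_vec_def x_index_def y_index_def restrict_def
      fun_eq_iff)

section \<open>Feasible solutions are encoded schedules\<close>

lemma binary_sum_eq_1E:
  fixes f :: "'a \<Rightarrow> int"
  assumes "finite A" "f \<in> A \<rightarrow> {0, 1}" "sum f A = 1"
  obtains t where "t \<in> A" "\<And>u. u \<in> A \<Longrightarrow> f u = of_bool (t = u)"
proof -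
  obtain t where t: "t \<in> A" "f t \<noteq> 0"
    using assms(3) by (metis sum.neutral zero_neq_one)
  then have "f t = 1"
    using assms(2) by auto
  then have "sum f (A - {t}) = 0"
    using assms t by (simp add: sum_diff1)
  moreover have "f u \<ge> 0" if "u \<in> A - {t}" for u
    using that assms(2) by (auto dest!: Pi_mem)
  ultimately have "\<forall>u\<in>A - {t}. f u = 0"
    using assms(1) sum_nonneg_eq_0_iff[of "A - {t}" f] by simp
  then have "f u = of_bool (t = u)" if "u \<in> A" for u
    using that \<open>f t = 1\<close> by (cases "u = t") auto
  with t show thesis
    using that by blast
qed

text \<open>By (a), the entries of \<open>x\<close> that belong to a job \<open>j\<close> form a
  unit vector over the pairs (slot, machine), and \<open>p j\<close> is the pair carrying the 1.
  Constraint (d) then fixes \<open>y\<close>.\<close>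

lemma feasible_imp_encode:
  assumes "finite M" "feasible J M (x, y)"
  obtains p where "p \<in> J \<rightarrow> slots J \<times> M" "(x, y) = encode J M p"
proof -
  have x: "x \<in> x_index J M \<rightarrow>\<^sub>E {0, 1}" and y: "y \<in> y_index J M \<rightarrow>\<^sub>E {0, 1}"
    and one_slot: "\<forall>j\<in>J. (\<Sum>i\<in>slots J. \<Sum>m\<in>M. x (i, j, m)) = 1"
    and y_sum: "\<forall>j\<in>J. \<forall>m\<in>M. y (j, m) = (\<Sum>i\<in>slots J. x (i, j, m))"
    using assms(2) unfolding feasible_def prod.case by blast+
  have "\<exists>t. t \<in> slots J \<times> M \<and> (\<forall>i\<in>slots J. \<forall>m\<in>M. x (i, j, m) = of_bool (t = (i, m)))"
    if j: "j \<in> J" for j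
  proof -
    have "(\<lambda>(i, m). x (i, j, m)) \<in> slots J \<times> M \<rightarrow> {0, 1}"
      using x j by (auto simp: x_index_def PiE_iff)
    moreover have "(\<Sum>(i, m)\<in>slots J \<times> M. x (i, j, m)) = 1"
      using bspec[OF one_slot j] unfolding sum.cartesian_product .
    moreover have "finite (slots J \<times> M)"
      using assms(1) by simp
    ultimately obtain t where t: "t \<in> slots J \<times> M"
      "\<And>u. u \<in> slots J \<times> M \<Longrightarrow> (\<lambda>(i, m). x (i, j, m)) u = of_bool (t = u)"
      using binary_sum_eq_1E[of "slots J \<times> M" "\<lambda>(i, m). x (i, j, m)"] by metis
    have "x (i, j, m) = of_bool (t = (i, m))" if "i \<in> slots J" "m \<in> M" for i m
      using that t(2)[of "(i, m)"] by simp
    with t(1) show ?thesis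
      by blast
  qed
  then have "\<exists>p. \<forall>j\<in>J. p j \<in> slots J \<times> M \<and>
      (\<forall>i\<in>slots J. \<forall>m\<in>M. x (i, j, m) = of_bool (p j = (i, m)))"
    by (rule bchoice[OF ballI])
  then obtain p where p: "\<And>j. j \<in> J \<Longrightarrow> p j \<in> slots J \<times> M"
    "\<And>i j m. i \<in> slots J \<Longrightarrow> j \<in> J \<Longrightarrow> m \<in> M \<Longrightarrow> x (i, j, m) = of_bool (p j = (i, m))"
    by blast
  have "x t = position_vec J M p t" for t
  proof (cases "t \<in> x_index J M")
    case True
    then show ?thesis
      by (auto simp: x_index_def p)
  next
    \<comment> \<open>Outside the index set both vectors are extensional and equal
      \<open>undefined\<close>.\<close>
    case False
    then show ?thesis
      by (simp add: position_vec_def PiE_arb[OF x])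
  qed
  moreover have "y t = machine_vec J M p t" for t
  proof (cases "t \<in> y_index J M")
    case True
    then obtain j m where t: "t = (j, m)" "j \<in> J" "m \<in> M"
      by (auto simp: y_index_def)
    have slot: "fst (p j) \<in> slots J"
      using p(1)[OF t(2)] by (simp add: mem_Times_iff)
    have "y t = (\<Sum>i'\<in>slots J. of_bool (p j = (i', m)))"
      using y_sum t by (simp add: p)
    \<comment> \<open>Only the slot \<open>fst (p j)\<close> can contribute, so the sum collapses to
      one term.\<close>
    also have "\<dots> = (\<Sum>i'\<in>slots J. if i' = fst (p j) then of_bool (snd (p j) = m) else 0)"
      by (intro sum.cong) (auto simp: prod_eq_iff)
    finally show ?thesis
      using slot t by simp
  next
    case False
    then show ?thesis
      by (simp add: machine_vec_def PiE_arb[OF y])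
  qed
  ultimately have "(x, y) = encode J M p"
    by (auto simp: encode_def)
  with p(1) show thesis
    using that by blast
qed

text \<open>Since \<open>p\<close> is injective, the sum over jobs reindexes to a sum over the
  occupied pairs, where at most one term is nonzero.\<close>

lemma sum_position_vec_jobs:
  assumes "finite J" "inj_on p J" "i \<in> slots J" "m \<in> M"
  shows "(\<Sum>j\<in>J. position_vec J M p (i, j, m)) = of_bool ((i, m) \<in> p ` J)"
proof -
  have "(\<Sum>j\<in>J. position_vec J M p (i, j, m)) = (\<Sum>j\<in>J. of_bool (p j = (i, m)))"
    using assms by simp
  also have "\<dots> = (\<Sum>t\<in>p ` J. if t = (i, m) then 1 else 0)"
    using assms(2) by (simp only: sum.reindex comp_def of_bool_def)
  finally show ?thesis
    using assms(1) by simp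
qed

text \<open>The encoding of any placement is binary and satisfies (a) and (d). What remains is (b),
  which forces injectivity, and (c), which then becomes the closure condition on occupied
  pairs.\<close>

lemma feasible_encode_iff:
  assumes "finite J" "finite M" "p \<in> J \<rightarrow> slots J \<times> M"
  shows "feasible J M (encode J M p) \<longleftrightarrow> schedule J M p"
proof -
  let ?x = "position_vec J M p" and ?y = "machine_vec J M p"
  have inj: "inj_on p J" if sum_le: "\<forall>i\<in>slots J. \<forall>m\<in>M. (\<Sum>j\<in>J. ?x (i, j, m)) \<le> 1"
  proof (rule inj_onI, rule ccontr)
    fix j j' assume jj: "j \<in> J" "j' \<in> J" "p j = p j'" "j \<noteq> j'"
    obtain i m where im: "p j = (i, m)" "i \<in> slots J" "m \<in> M"
      using assms(3) jj(1) by blast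
    \<comment> \<open>Two jobs sharing a pair would already contribute 2 to the sum bounded by
      (b).\<close>
    have "2 = (\<Sum>k\<in>{j, j'}. ?x (i, k, m))"
      using jj im by simp
    also have "\<dots> \<le> (\<Sum>k\<in>J. ?x (i, k, m))"
      using jj im assms(1) by (intro sum_mono2) auto
    finally show False
      using sum_le im by fastforce
  qed
  have "(\<Sum>i\<in>slots J. \<Sum>m\<in>M. ?x (i, j, m)) = 1" if "j \<in> J" for j
  proof -
    have "(\<Sum>i\<in>slots J. \<Sum>m\<in>M. ?x (i, j, m)) = (\<Sum>t\<in>slots J \<times> M. of_bool (t = p j))"
      using that by (auto simp: sum.cartesian_product intro!: sum.cong)
    also have "\<dots> = 1"
      using that assms by (auto simp: of_bool_def finite_cartesian_product)
    finally show ?thesis .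
  qed
  moreover have "?y (j, m) = (\<Sum>i\<in>slots J. ?x (i, j, m))" if jm: "j \<in> J" "m \<in> M" for j m
  proof -
    have "(\<Sum>i\<in>slots J. ?x (i, j, m))
        = (\<Sum>i\<in>slots J. if i = fst (p j) then of_bool (snd (p j) = m) else 0)"
      using jm by (intro sum.cong) (auto simp: prod_eq_iff)
    then show ?thesis
      using jm assms(3) by (auto simp: Pi_iff mem_Times_iff)
  qed
  moreover have "?x \<in> x_index J M \<rightarrow>\<^sub>E {0, 1}" "?y \<in> y_index J M \<rightarrow>\<^sub>E {0, 1}"
    by (auto simp: position_vec_def machine_vec_def)
  ultimately have "feasible J M (encode J M p) \<longleftrightarrow>
     (\<forall>i\<in>slots J. \<forall>m\<in>M. (\<Sum>j\<in>J. ?x (i, j, m)) \<le> 1) \<and>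
     (\<forall>i\<in>{2..card J}. \<forall>m\<in>M. (\<Sum>j\<in>J. ?x (i, j, m)) \<ge> (\<Sum>j\<in>J. ?x (i - 1, j, m)))"
    by (simp add: feasible_def encode_def)
  also have "\<dots> \<longleftrightarrow> inj_on p J \<and>
     (\<forall>i\<in>{2..card J}. \<forall>m\<in>M. (\<Sum>j\<in>J. ?x (i, j, m)) \<ge> (\<Sum>j\<in>J. ?x (i - 1, j, m)))"
    using inj by (auto simp: sum_position_vec_jobs[OF assms(1)] simp del: position_vec_apply)
  also have "\<dots> \<longleftrightarrow> schedule J M p"
  \<comment> \<open>The sums in (c) are indicators of occupied pairs only for injective
    \<open>p\<close>; otherwise both sides are false.\<close>
  proof (cases "inj_on p J")
    case True
    have "(\<Sum>j\<in>J. ?x (i, j, m)) \<ge> (\<Sum>j\<in>J. ?x (i - 1, j, m))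
        \<longleftrightarrow> ((i - 1, m) \<in> p ` J \<longrightarrow> (i, m) \<in> p ` J)"
      if "i \<in> {2..card J}" "m \<in> M" for i m
    proof -
      have "i \<in> slots J" "i - 1 \<in> slots J"
        using that by (auto simp: slots_def)
      then show ?thesis
        using that True assms(1) by (simp add: sum_position_vec_jobs del: position_vec_apply)
    qed
    then show ?thesis
      using True assms(3) unfolding schedule_def by blast
  qed (simp add: schedule_def)
  finally show ?thesis .
qed

lemma feasible_imp_schedule:
  assumes "finite J" "finite M" "feasible J M s"
  obtains p where "schedule J M p" "s = encode J M p"
proof -
  obtain p where "p \<in> J \<rightarrow> slots J \<times> M" "s = encode J M p"
    using feasible_imp_encode[OF assms(2)] assms(3) by (metis surj_pair)
  then show thesis
    using feasible_encode_iff[OF assms(1,2)] assms(3) that by blast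
qed

section \<open>Occupied slots as final segments given by the load\<close>

lemma occupied_slots_position_vec:
  assumes "p \<in> J \<rightarrow> slots J \<times> M" "m \<in> M"
  shows "occupied_slots J (position_vec J M p) m = {i. (i, m) \<in> p ` J}"
proof (intro set_eqI)
  fix i
  show "i \<in> occupied_slots J (position_vec J M p) m \<longleftrightarrow> i \<in> {i. (i, m) \<in> p ` J}"
    using placement_coords(1)[OF assms(1), of _ i m] assms(2)
    unfolding occupied_slots_def by (auto simp: image_iff) (metis position_vec_apply of_bool_eq(2))
qed

text \<open>Closure under successors fills everything from \<open>Min A\<close> up to
  \<open>n\<close>. The half-open interval also covers the empty set.\<close>

lemma final_segment_eq:
  fixes A :: "nat set"
  assumes "A \<subseteq> {1..n}" "\<And>i. i \<in> A \<Longrightarrow> i < n \<Longrightarrow> Suc i \<in> A"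
  shows "A = {n - card A<..n}"
proof (cases "A = {}")
  case False
  have fin: "finite A"
    using assms(1) finite_subset by blast
  define a where "a = Min A"
  have a: "a \<in> A" "\<And>i. i \<in> A \<Longrightarrow> a \<le> i"
    using False fin by (auto simp: a_def)
  have "i \<in> A" if "a \<le> i" "i \<le> n" for i
    using that by (induction i rule: dec_induct) (auto simp: a assms(2))
  then have "A = {a..n}"
    using a assms(1) by fastforce
  \<comment> \<open>These bounds give \<open>n - card A = a - 1\<close> without truncation at
    0.\<close>
  moreover have "1 \<le> a" "a \<le> n"
    using a(1) assms(1) by auto
  ultimately show ?thesis
    by auto
qed simp

text \<open>The slots used on \<open>m\<close> are closed under successors, and injectivity makes
  their number the load. All later arguments about slots reduce to loads through this fact.\<close>

lemma schedule_occupied: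
  assumes "finite J" "schedule J M p" "m \<in> M"
  shows "(i, m) \<in> p ` J \<longleftrightarrow> card J - load J p m < i \<and> i \<le> card J"
proof -
  let ?A = "{i. (i, m) \<in> p ` J}"
  have "?A \<subseteq> {1..card J}"
  proof
    fix i assume "i \<in> ?A"
    then obtain j where "j \<in> J" "p j = (i, m)"
      by auto
    then have "i \<in> slots J"
      using placement_coords(1) assms(2) unfolding schedule_def by metis
    then show "i \<in> {1..card J}"
      by (simp add: slots_def)
  qed
  moreover have "Suc i \<in> ?A" if "i \<in> ?A" "i < card J" for i
  proof -
    \<comment> \<open>The lower bound needs \<open>i \<ge> 1\<close>, which comes from the inclusion
      just accumulated in \<open>calculation\<close>.\<close>
    have "Suc i \<in> {2..card J}"
      using that calculation by auto
    then show ?thesis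
      using assms(2,3) that unfolding schedule_def
      by (metis diff_Suc_1 mem_Collect_eq)
  qed
  ultimately have "?A = {card J - card ?A<..card J}"
    by (rule final_segment_eq)
  moreover have "card ?A = load J p m"
  proof -
    have "?A = (fst \<circ> p) ` {j \<in> J. snd (p j) = m}"
      by (auto simp: image_iff) (metis fst_conv snd_conv)
    moreover have "inj_on (fst \<circ> p) {j \<in> J. snd (p j) = m}"
      using assms(2) by (auto simp: schedule_def inj_on_def prod_eq_iff)
    ultimately show ?thesis
      by (simp only: load_def card_image)
  qed
  ultimately show ?thesis
    by auto
qed

lemma load_le: "finite J \<Longrightarrow> load J p m \<le> card J"
  by (auto simp: load_def intro: card_mono)

lemma load_pos_iff: "finite J \<Longrightarrow> 0 < load J p m \<longleftrightarrow> (\<exists>j\<in>J. snd (p j) = m)"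
  by (auto simp: load_def card_gt_0_iff)

lemma occupied_slots_schedule:
  assumes "finite J" "schedule J M p" "m \<in> M"
  shows "occupied_slots J (position_vec J M p) m = {card J - load J p m<..card J}"
  using occupied_slots_position_vec[of p J M m] schedule_occupied[OF assms] assms
  by (auto simp: schedule_def)

lemma Min_greaterThanAtMost: "a < b \<Longrightarrow> Min {a<..b} = Suc a" for a b :: nat
  by (intro Min_eqI) auto

lemma Min_occupied_slots:
  assumes "finite J" "schedule J M p" "j \<in> J"
  shows "Min (occupied_slots J (position_vec J M p) (snd (p j)))
    = Suc (card J - load J p (snd (p j)))"
proof -
  have "snd (p j) \<in> M"
    using assms by (auto simp: schedule_def Pi_iff mem_Times_iff)
  moreover have "0 < load J p (snd (p j))"
    using assms by (auto simp: load_pos_iff)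
  ultimately show ?thesis
    using load_le[OF assms(1), of p "snd (p j)"]
    by (simp add: occupied_slots_schedule[OF assms(1,2)] Min_greaterThanAtMost)
qed

text \<open>Both branches of \<open>new_start_slot\<close> agree with one formula: an empty machine
  has load 0, and otherwise the first occupied slot is the successor of
  \<open>card J - load J p m\<close>.\<close>

lemma new_start_slot_schedule:
  assumes "finite J" "schedule J M p" "m \<in> M"
  shows "new_start_slot J (position_vec J M p) m = card J - load J p m"
  using load_le[OF assms(1), of p m]
  by (auto simp: new_start_slot_def occupied_slots_schedule[OF assms] Min_greaterThanAtMost)

section \<open>Distance of two solutions counted in jobs\<close>

lemma card_diff_position_vec:
  assumes "finite J" "p \<in> J \<rightarrow> slots J \<times> M" "q \<in> J \<rightarrow> slots J \<times> M"
  shows "card {t \<in> x_index J M. position_vec J M q t \<noteq> position_vec J M p t}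
    = 2 * card (moved_jobs J p q)"
proof -
  let ?D = "moved_jobs J p q"
  let ?f = "\<lambda>r j. (fst (r j), j, snd (r j))"
  \<comment> \<open>Each moved job flips exactly two coordinates: its old position from 1 to 0 and
    its new one from 0 to 1.\<close>
  have "{t \<in> x_index J M. position_vec J M q t \<noteq> position_vec J M p t} = ?f p ` ?D \<union> ?f q ` ?D"
    using assms(2,3) by (fastforce simp: x_index_def moved_jobs_def image_iff Pi_iff)
  moreover have "?f p ` ?D \<inter> ?f q ` ?D = {}"
    by (auto simp: moved_jobs_def prod_eq_iff)
  moreover have "card (?f p ` ?D) = card ?D" "card (?f q ` ?D) = card ?D"
    by (auto intro!: card_image inj_onI)
  moreover have "finite ?D"
    using assms(1) by (simp add: moved_jobs_def)
  ultimately show ?thesis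
    by (simp add: card_Un_disjoint)
qed

lemma card_diff_machine_vec:
  assumes "finite J" "p \<in> J \<rightarrow> slots J \<times> M" "q \<in> J \<rightarrow> slots J \<times> M"
  shows "card {t \<in> y_index J M. machine_vec J M q t \<noteq> machine_vec J M p t}
    = 2 * card (reassigned_jobs J p q)"
proof -
  let ?E = "reassigned_jobs J p q"
  let ?f = "\<lambda>r j. (j, snd (r j))"
  have "{t \<in> y_index J M. machine_vec J M q t \<noteq> machine_vec J M p t} = ?f p ` ?E \<union> ?f q ` ?E"
    using assms(2,3) by (fastforce simp: y_index_def reassigned_jobs_def image_iff Pi_iff)
  moreover have "?f p ` ?E \<inter> ?f q ` ?E = {}"
    by (auto simp: reassigned_jobs_def)
  moreover have "card (?f p ` ?E) = card ?E" "card (?f q ` ?E) = card ?E"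
    by (auto intro!: card_image inj_onI)
  moreover have "finite ?E"
    using assms(1) by (simp add: reassigned_jobs_def)
  ultimately show ?thesis
    by (simp add: card_Un_disjoint)
qed

lemma local_branching_lhs_encode:
  assumes "finite J" "finite M" "p \<in> J \<rightarrow> slots J \<times> M" "q \<in> J \<rightarrow> slots J \<times> M"
  shows "local_branching_lhs J M (encode J M p) (encode J M q)
    = int (card (moved_jobs J p q) + card (reassigned_jobs J p q))"
proof -
  \<comment> \<open>Every job lies on exactly one machine of \<open>M\<close>, so the sums over
    machines regroup into a single sum over jobs.\<close>
  have fibre: "(\<Sum>m\<in>M. \<Sum>j\<in>{j \<in> J. snd (p j) = m}. g j) = (\<Sum>j\<in>J. g j)" for g :: "_ \<Rightarrow> int"
    using assms by (intro sum.group) (auto simp: Pi_iff mem_Times_iff)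
  have "(\<Sum>m\<in>M. \<Sum>j\<in>{j \<in> J. machine_vec J M p (j, m) = 1}. 1 - machine_vec J M q (j, m))
      = (\<Sum>m\<in>M. \<Sum>j\<in>{j \<in> J. snd (p j) = m}. of_bool (snd (p j) \<noteq> snd (q j)))"
    by (intro sum.cong) auto
  also have "\<dots> = int (card (reassigned_jobs J p q))"
    unfolding fibre using assms(1) by (simp add: reassigned_jobs_def Int_def)
  finally have y: "(\<Sum>m\<in>M. \<Sum>j\<in>{j \<in> J. machine_vec J M p (j, m) = 1}. 1 - machine_vec J M q (j, m))
      = int (card (reassigned_jobs J p q))" .
  have "(\<Sum>(i, j)\<in>{(i, j). i \<in> slots J \<and> j \<in> J \<and> position_vec J M p (i, j, m) = 1}.
          1 - position_vec J M q (i, j, m))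
      = (\<Sum>j\<in>{j \<in> J. snd (p j) = m}. of_bool (p j \<noteq> q j))" if "m \<in> M" for m
    using that assms(3)
    \<comment> \<open>On a fixed machine a job determines its slot, so the pairs
      \<open>(i, j)\<close> with reference entry 1 correspond to the jobs on
      \<open>m\<close>.\<close>
    by (intro sum.reindex_bij_witness[of _ "\<lambda>j. (fst (p j), j)" snd])
      (auto simp: Pi_iff mem_Times_iff)
  then have "(\<Sum>m\<in>M. \<Sum>(i, j)\<in>{(i, j). i \<in> slots J \<and> j \<in> J \<and> position_vec J M p (i, j, m) = 1}.
          1 - position_vec J M q (i, j, m)) = (\<Sum>j\<in>J. of_bool (p j \<noteq> q j))"
    unfolding fibre[symmetric] by (intro sum.cong refl)
  also have "\<dots> = int (card (moved_jobs J p q))"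
    using assms(1) by (simp add: moved_jobs_def Int_def)
  finally have x: "(\<Sum>m\<in>M. \<Sum>(i, j)\<in>{(i, j). i \<in> slots J \<and> j \<in> J \<and> position_vec J M p (i, j, m) = 1}.
          1 - position_vec J M q (i, j, m)) = int (card (moved_jobs J p q))" .
  show ?thesis
    unfolding local_branching_lhs_def encode_def prod.case x y by simp
qed

section \<open>Swaps and shifts as updates of placements\<close>

definition swap_placement :: "('j \<Rightarrow> nat \<times> 'm) \<Rightarrow> 'j \<Rightarrow> 'j \<Rightarrow> 'j \<Rightarrow> nat \<times> 'm" where
  "swap_placement p j j' = p(j := p j', j' := p j)"

text \<open>In a schedule the target slot is the last free slot of \<open>m\<close>, which is the
  value of \<open>new_start_slot\<close>.\<close>

definition shift_placement ::
    "'j set \<Rightarrow> ('j \<Rightarrow> nat \<times> 'm) \<Rightarrow> 'j \<Rightarrow> 'm \<Rightarrow> 'j \<Rightarrow> nat \<times> 'm" where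
  "shift_placement J p j m = p(j := (card J - load J p m, m))"

lemma encode_swap_placement:
  assumes "p \<in> J \<rightarrow> slots J \<times> M" "inj_on p J" "j \<in> J" "j' \<in> J" "j \<noteq> j'"
    "p j = (i, m)" "p j' = (i', m)"
  shows "encode J M (swap_placement p j j')
    = ((position_vec J M p)((i, j, m) := 0, (i', j', m) := 0, (i', j, m) := 1, (i, j', m) := 1),
       machine_vec J M p)"
proof -
  have "i \<in> slots J" "i' \<in> slots J" "m \<in> M"
    using placement_coords[OF assms(1)] assms by metis+
  \<comment> \<open>Distinct slots make the four updated coordinates distinct, so the updates do not
    overwrite each other.\<close>
  moreover have "i \<noteq> i'"
    using assms by (auto simp: inj_on_def)
  ultimately show ?thesis
    using assms(3-)
    by (auto simp: encode_def swap_placement_def position_vec_def machine_vec_def x_index_def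
        y_index_def restrict_def fun_eq_iff)
qed

lemma internal_swap_encode_iff:
  assumes "schedule J M p"
  shows "internal_swap J M (encode J M p) s \<longleftrightarrow>
    (\<exists>j\<in>J. \<exists>j'\<in>J. j \<noteq> j' \<and> snd (p j) = snd (p j') \<and> s = encode J M (swap_placement p j j'))"
    (is "?L \<longleftrightarrow> ?R")
proof
  have p: "p \<in> J \<rightarrow> slots J \<times> M" "inj_on p J"
    using assms by (auto simp: schedule_def)
  show ?R if L: ?L
  proof -
    obtain m j j' i i' where *: "m \<in> M" "j \<in> J" "j' \<in> J" "i \<in> slots J" "i' \<in> slots J" "j \<noteq> j'"
      "position_vec J M p (i, j, m) = 1" "position_vec J M p (i', j', m) = 1"
      and s: "s = ((position_vec J M p)((i, j, m) := 0, (i', j', m) := 0, (i', j, m) := 1,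
        (i, j', m) := 1), machine_vec J M p)"
      using L unfolding internal_swap_def encode_def by (cases s) (simp only: prod.case, blast)
    then have "p j = (i, m)" "p j' = (i', m)"
      by auto
    with * show ?thesis
      unfolding s using encode_swap_placement[OF p] by (metis snd_conv)
  qed
  show ?L if R: ?R
  proof -
    obtain j j' where *: "j \<in> J" "j' \<in> J" "j \<noteq> j'" "snd (p j) = snd (p j')"
      "s = encode J M (swap_placement p j j')"
      using R by blast
    then obtain i i' m where im: "p j = (i, m)" "p j' = (i', m)"
      by (metis prod.collapse)
    then have mem: "i \<in> slots J" "i' \<in> slots J" "m \<in> M"
      using * placement_coords[OF p(1)] by metis+
    show ?thesis
      unfolding *(5) encode_swap_placement[OF p *(1-3) im]
      unfolding internal_swap_def encode_def prod.case
      by (rule bexI[of _ m], rule bexI[of _ j], rule bexI[of _ j'], rule bexI[of _ i],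
          rule bexI[of _ i']) (use * im mem in auto)
  qed
qed

text \<open>The job \<open>j\<close> is not on \<open>m\<close>, so \<open>m\<close> does not carry
  all jobs and the difference is at least 1.\<close>

lemma new_start_slot_in_slots:
  assumes "finite J" "j \<in> J" "snd (p j) \<noteq> m"
  shows "card J - load J p m \<in> slots J"
proof -
  have "load J p m < card J"
    unfolding load_def using assms by (intro psubset_card_mono) auto
  then show ?thesis
    by (auto simp: slots_def)
qed

lemma encode_shift_placement:
  assumes "finite J" "p \<in> J \<rightarrow> slots J \<times> M" "j \<in> J" "p j = (i, m)" "m \<noteq> m'" "m' \<in> M"
  shows "encode J M (shift_placement J p j m')
    = ((position_vec J M p)((i, j, m) := 0, (card J - load J p m', j, m') := 1),
       (machine_vec J M p)((j, m) := 0, (j, m') := 1))"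
proof -
  have "i \<in> slots J" "m \<in> M"
    using placement_coords[OF assms(2-4)] .
  moreover have "card J - load J p m' \<in> slots J"
    using new_start_slot_in_slots[of J j p m'] assms by simp
  ultimately show ?thesis
    using assms(3-)
    by (auto simp: encode_def shift_placement_def position_vec_def machine_vec_def x_index_def
        y_index_def restrict_def fun_eq_iff)
qed

lemma starting_job_shift_encode_iff:
  assumes "finite J" "schedule J M p"
  shows "starting_job_shift J M (encode J M p) s \<longleftrightarrow>
    (\<exists>j\<in>J. \<exists>m\<in>M. m \<noteq> snd (p j) \<and> fst (p j) = Suc (card J - load J p (snd (p j))) \<and>
       s = encode J M (shift_placement J p j m))"
    (is "?L \<longleftrightarrow> ?R")
proof
  have p: "p \<in> J \<rightarrow> slots J \<times> M"
    using assms by (auto simp: schedule_def)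
  show ?R if L: ?L
  proof -
    obtain m m' j i where *: "m \<in> M" "m' \<in> M" "j \<in> J" "m \<noteq> m'"
      "occupied_slots J (position_vec J M p) m \<noteq> {}"
      "i = Min (occupied_slots J (position_vec J M p) m)" "position_vec J M p (i, j, m) = 1"
      and s: "s = ((position_vec J M p)((i, j, m) := 0,
          (new_start_slot J (position_vec J M p) m', j, m') := 1),
        (machine_vec J M p)((j, m) := 0, (j, m') := 1))"
      using L unfolding starting_job_shift_def encode_def by (cases s) (simp only: prod.case, blast)
    \<comment> \<open>The minimum of a nonempty finite set is a member, so \<open>i\<close> is a
      slot. This allows \<open>p j\<close> to be read off \<open>position_vec\<close>, which is
      \<open>undefined\<close> outside its index set.\<close>
    have "finite (occupied_slots J (position_vec J M p) m)"
      by (simp add: occupied_slots_def)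
    then have "i \<in> occupied_slots J (position_vec J M p) m"
      using *(5,6) Min_in by blast
    then have "i \<in> slots J"
      by (simp add: occupied_slots_def)
    then have pj: "p j = (i, m)"
      using * by auto
    moreover have "s = encode J M (shift_placement J p j m')"
      unfolding s encode_shift_placement[OF assms(1) p *(3) pj *(4,2)]
      by (simp add: new_start_slot_schedule[OF assms *(2)])
    ultimately show ?thesis
      using * Min_occupied_slots[OF assms *(3)] by (intro bexI[of _ j] bexI[of _ m']) auto
  qed
  show ?L if R: ?R
  proof -
    obtain j m' where *: "j \<in> J" "m' \<in> M" "m' \<noteq> snd (p j)"
      "fst (p j) = Suc (card J - load J p (snd (p j)))"
      "s = encode J M (shift_placement J p j m')"
      using R by blast
    obtain i m where im: "p j = (i, m)"
      by fastforce
    then have mem: "i \<in> slots J" "m \<in> M"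
      using placement_coords[OF p *(1)] by metis+
    then have occ: "i \<in> occupied_slots J (position_vec J M p) m"
      using * im by (auto simp: occupied_slots_def intro!: bexI[of _ j])
    have min: "i = Min (occupied_slots J (position_vec J M p) m)"
      using Min_occupied_slots[OF assms *(1)] *(4) im by simp
    have "m \<noteq> m'"
      using *(3) im by auto
    show ?thesis
      unfolding *(5) encode_shift_placement[OF assms(1) p *(1) im \<open>m \<noteq> m'\<close> *(2)]
      unfolding starting_job_shift_def encode_def prod.case
      by (rule bexI[of _ m], rule bexI[of _ m'], rule bexI[of _ j])
        (use *(1,2) im mem occ min \<open>m \<noteq> m'\<close> new_start_slot_schedule[OF assms *(2)] in auto)
  qed
qed

section \<open>Swaps and shifts preserve schedules\<close>

lemma schedule_swap_placement:
  assumes "schedule J M p" "j \<in> J" "j' \<in> J"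
  shows "schedule J M (swap_placement p j j')"
proof -
  let ?q = "swap_placement p j j'"
  \<comment> \<open>The occupied pairs are only permuted among jobs, so the final segments
    survive.\<close>
  have "?q ` J = p ` J"
    using assms(2,3) by (auto simp: swap_placement_def image_iff)
  moreover have "inj_on ?q J"
    using assms by (auto simp: schedule_def inj_on_def swap_placement_def)
  moreover have "?q \<in> J \<rightarrow> slots J \<times> M"
    using assms by (auto simp: schedule_def swap_placement_def Pi_iff)
  ultimately show ?thesis
    using assms(1) by (simp add: schedule_def)
qed

text \<open>A final segment stays final when its first slot is removed or when the slot just before
  it is added.\<close>

lemma schedule_shift_placement:
  assumes "finite J" "schedule J M p" "j \<in> J" "m \<in> M" "m \<noteq> snd (p j)"
    "fst (p j) = Suc (card J - load J p (snd (p j)))"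
  shows "schedule J M (shift_placement J p j m)"
proof -
  let ?c = "card J - load J p m" and ?q = "shift_placement J p j m"
  have p: "p \<in> J \<rightarrow> slots J \<times> M" "inj_on p J"
    using assms(2) by (auto simp: schedule_def)
  have new: "(?c, m) \<notin> p ` J"
    using schedule_occupied[OF assms(1,2,4)] by simp
  have "?q \<in> J \<rightarrow> slots J \<times> M"
    using p(1) assms(4) new_start_slot_in_slots[of J j p m] assms(1,3,5)
    by (auto simp: shift_placement_def Pi_iff simp del: mem_Sigma_iff)
  moreover have "inj_on ?q J"
    using p(2) new unfolding shift_placement_def
    by (intro inj_on_fun_updI) (auto simp: image_iff)
  moreover have "(i, m1) \<in> ?q ` J" if i: "i \<in> {2..card J}" "m1 \<in> M" "(i - 1, m1) \<in> ?q ` J" for i m1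
  proof -
    \<comment> \<open>A job other than \<open>j\<close> keeps its position under the shift, so it
      suffices that such a job holds the pair.\<close>
    have "\<exists>k\<in>J. k \<noteq> j \<and> p k = (i, m1)"
    proof (cases "i - 1 = ?c \<and> m1 = m")
      \<comment> \<open>Slot \<open>i\<close> follows the newly taken slot, so it is the former
        first occupied slot of \<open>m\<close>. For empty \<open>m\<close> this case cannot occur,
        as \<open>?c\<close> is then \<open>card J\<close>.\<close>
      case True
      then have "(i, m1) \<in> p ` J"
        using i schedule_occupied[OF assms(1,2,4)] by auto
      then obtain k where "k \<in> J" "p k = (i, m1)"
        by auto
      then show ?thesis
        using True assms(5) by (metis snd_conv)
    next
      \<comment> \<open>The predecessor was already occupied, so slot \<open>i\<close> lies strictly
        above the first occupied slot of \<open>m1\<close> and cannot hold the starting job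
        \<open>j\<close>.\<close>
      case False
      then have "(i - 1, m1) \<in> p ` J"
        using i(3) by (auto simp: shift_placement_def split: if_splits)
      then have low: "card J - load J p m1 < i - 1" and "(i, m1) \<in> p ` J"
        using assms(2) i schedule_occupied[OF assms(1,2) i(2)] by (auto simp: schedule_def)
      then obtain k where k: "k \<in> J" "p k = (i, m1)"
        by auto
      moreover have "k \<noteq> j"
        using k low assms(6) by auto
      ultimately show ?thesis
        by blast
    qed
    then show ?thesis
      by (force simp: shift_placement_def)
  qed
  ultimately show ?thesis
    by (simp add: schedule_def)
qed

section \<open>Solutions within the distance bound\<close>

lemma schedule_image_eq:
  assumes "finite J" "schedule J M p" "schedule J M q" "\<And>j. j \<in> J \<Longrightarrow> snd (p j) = snd (q j)"
  shows "p ` J = q ` J"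
proof -
  \<comment> \<open>Equal machine assignments give equal loads, and these determine the occupied
    slots.\<close>
  have "load J p m = load J q m" for m
    unfolding load_def by (intro arg_cong[of _ _ card]) (auto simp: assms(4))
  then have on_M: "(i, m) \<in> p ` J \<longleftrightarrow> (i, m) \<in> q ` J" if "m \<in> M" for i m
    using schedule_occupied[OF assms(1,2) that] schedule_occupied[OF assms(1,3) that] by simp
  have off_M: "(i, m) \<notin> p ` J" "(i, m) \<notin> q ` J" if "m \<notin> M" for i m
    using that assms(2,3) by (auto simp: schedule_def dest!: Pi_mem)
  show ?thesis
  proof (intro set_eqI)
    fix t
    show "t \<in> p ` J \<longleftrightarrow> t \<in> q ` J"
      using on_M[of "snd t" "fst t"] off_M[of "snd t" "fst t"] by (cases "snd t \<in> M") simp_all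
  qed
qed

text \<open>With the two schedules exchanged, this also gives the slot that the job leaves.\<close>

lemma single_reassigned_slot:
  assumes "finite J" "schedule J M p" "schedule J M q" "j \<in> J"
    "\<And>k. k \<in> J \<Longrightarrow> k \<noteq> j \<Longrightarrow> p k = q k" "snd (p j) \<noteq> snd (q j)"
  shows "fst (q j) = card J - load J p (snd (q j))"
    and "load J q (snd (q j)) = Suc (load J p (snd (q j)))"
proof -
  let ?m = "snd (q j)"
  have "{k \<in> J. snd (q k) = ?m} = insert j {k \<in> J. snd (p k) = ?m}"
    using assms(4,5) by force
  then show load: "load J q ?m = Suc (load J p ?m)"
    using assms(1,6) by (simp add: load_def)
  have m: "?m \<in> M"
    using assms(3,4) by (auto simp: schedule_def Pi_iff mem_Times_iff)
  \<comment> \<open>This is the last free slot of \<open>?m\<close> under \<open>p\<close>. The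
    additional job makes it occupied under \<open>q\<close>, and no unmoved job can hold it.\<close>
  let ?c = "card J - load J p ?m"
  have "(?c, ?m) \<in> q ` J"
    using schedule_occupied[OF assms(1,3) m] load load_le[OF assms(1), of q ?m] by auto
  then obtain k where k: "k \<in> J" "q k = (?c, ?m)"
    by auto
  have "(?c, ?m) \<notin> p ` J"
    using schedule_occupied[OF assms(1,2) m] by simp
  then have "k = j"
    using k assms(5) by (metis imageI)
  then show "fst (q j) = ?c"
    using k(2) by (metis fst_conv)
qed

text \<open>A reassigned job is also moved and so counts twice; one such job exhausts the
  bound.\<close>

lemma few_moves_cases:
  assumes "finite J" "schedule J M p" "schedule J M q"
    "card (moved_jobs J p q) + card (reassigned_jobs J p q) \<le> 2"
  shows "encode J M q \<in> swap_shift_neighbourhood J M (encode J M p)"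
proof -
  let ?D = "moved_jobs J p q" and ?E = "reassigned_jobs J p q"
  have fin: "finite ?D" "finite ?E" and sub: "?E \<subseteq> ?D"
    using assms(1) by (auto simp: moved_jobs_def reassigned_jobs_def)
  have unmoved: "p k = q k" if "k \<in> J" "k \<notin> ?D" for k
    using that by (simp add: moved_jobs_def)
  show ?thesis
  proof (cases "?E = {}")
    case True
    then have snd_eq: "snd (p j) = snd (q j)" if "j \<in> J" for j
      using that by (auto simp: reassigned_jobs_def)
    then have img: "p ` J = q ` J"
      using schedule_image_eq[OF assms(1-3)] by blast
    \<comment> \<open>The pair that \<open>j\<close> enters was held by another job under
      \<open>p\<close>, and injectivity of \<open>q\<close> forces that job to move as well. So a
      single moved job is impossible here.\<close>
    have partner: "\<exists>k\<in>?D. k \<noteq> j \<and> q j = p k" if j: "j \<in> ?D" for j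
    proof -
      have "j \<in> J" "p j \<noteq> q j"
        using j by (auto simp: moved_jobs_def)
      then obtain k where k: "k \<in> J" "q j = p k"
        using img by (metis imageE imageI)
      moreover have "k \<noteq> j"
        using k \<open>p j \<noteq> q j\<close> by auto
      moreover have "k \<in> ?D"
        using unmoved k \<open>k \<noteq> j\<close> \<open>j \<in> J\<close> assms(3) by (metis inj_onD schedule_def)
      ultimately show ?thesis
        by blast
    qed
    have "card ?D \<le> 2"
      using assms(4) by simp
    show ?thesis
    proof (cases "?D = {}")
      case True
      then have "encode J M q = encode J M p"
        using unmoved by (intro encode_cong) auto
      then show ?thesis
        by (simp add: swap_shift_neighbourhood_def)
    next
      case False
      then obtain j j' where jj: "j \<in> ?D" "j' \<in> ?D" "j \<noteq> j'"
        using partner by blast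
      then have D: "?D = {j, j'}"
        using card_seteq[OF fin(1), of "{j, j'}"] \<open>card ?D \<le> 2\<close> by auto
      have q: "q j = p j'" "q j' = p j"
        using partner[OF jj(1)] partner[OF jj(2)] D by auto
      have J: "j \<in> J" "j' \<in> J"
        using jj by (auto simp: moved_jobs_def)
      have "encode J M q = encode J M (swap_placement p j j')"
        using q unmoved D by (intro encode_cong) (auto simp: swap_placement_def)
      moreover have "snd (p j) = snd (p j')"
        using q snd_eq J by metis
      ultimately have "internal_swap J M (encode J M p) (encode J M q)"
        using internal_swap_encode_iff[OF assms(2)] J jj(3) by blast
      then show ?thesis
        by (simp add: swap_shift_neighbourhood_def)
    qed
  next
    case False
    then obtain j where j: "j \<in> ?E"
      by blast
    have "card ?E \<ge> 1"
      using False fin(2) by (simp add: Suc_leI card_gt_0_iff)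
    then have "card ?D \<le> 1"
      using assms(4) by simp
    then have D: "?D = {j}"
      using card_seteq[OF fin(1), of "{j}"] j sub by auto
    have jJ: "j \<in> J" "snd (p j) \<noteq> snd (q j)"
      using j by (auto simp: reassigned_jobs_def)
    have other: "p k = q k" if "k \<in> J" "k \<noteq> j" for k
      using unmoved that D by blast
    note new = single_reassigned_slot[OF assms(1-3) jJ(1) other jJ(2)]
    \<comment> \<open>With the roles of \<open>p\<close> and \<open>q\<close> exchanged, the slot
      left by \<open>j\<close> is the last free slot of its old machine under
      \<open>q\<close>.\<close>
    have old: "fst (p j) = card J - load J q (snd (p j))"
      "load J p (snd (p j)) = Suc (load J q (snd (p j)))"
      using single_reassigned_slot[OF assms(1,3,2) jJ(1)] other jJ(2) by metis+
    \<comment> \<open>The load under \<open>q\<close> is one smaller; \<open>load_le\<close>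
      excludes truncation when the successor is pulled out.\<close>
    then have "fst (p j) = Suc (card J - load J p (snd (p j)))"
      using load_le[OF assms(1), of p "snd (p j)"] by simp
    moreover have "encode J M q = encode J M (shift_placement J p j (snd (q j)))"
      using new(1) other by (intro encode_cong) (auto simp: shift_placement_def prod_eq_iff)
    moreover have "snd (q j) \<in> M"
      using assms(3) jJ by (auto simp: schedule_def Pi_iff mem_Times_iff)
    ultimately have "starting_job_shift J M (encode J M p) (encode J M q)"
      using starting_job_shift_encode_iff[OF assms(1,2)] jJ by metis
    then show ?thesis
      by (simp add: swap_shift_neighbourhood_def)
  qed
qed

text \<open>A swap moves at most two jobs and reassigns none; a shift moves and reassigns at most
  one. Since the result is an encoded schedule, every neighbour is feasible.\<close>

lemma swap_shift_neighbourhoodD: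
  assumes "finite J" "schedule J M p" "s \<in> swap_shift_neighbourhood J M (encode J M p)"
  obtains q where "schedule J M q" "s = encode J M q"
    "card (moved_jobs J p q) + card (reassigned_jobs J p q) \<le> 2"
proof -
  consider "s = encode J M p" | "internal_swap J M (encode J M p) s"
    | "starting_job_shift J M (encode J M p) s"
    using assms(3) by (auto simp: swap_shift_neighbourhood_def)
  then show thesis
  proof cases
    case 1
    then show thesis
      using assms(2) by (intro that[of p]) (auto simp: moved_jobs_def reassigned_jobs_def)
  next
    case 2
    then obtain j j' where *: "j \<in> J" "j' \<in> J" "j \<noteq> j'" "snd (p j) = snd (p j')"
      "s = encode J M (swap_placement p j j')"
      using internal_swap_encode_iff[OF assms(2)] by blast
    let ?q = "swap_placement p j j'"
    have "card (moved_jobs J p ?q) \<le> card {j, j'}"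
      by (intro card_mono) (auto simp: moved_jobs_def swap_placement_def split: if_splits)
    moreover have "reassigned_jobs J p ?q = {}"
      using *(4) by (auto simp: reassigned_jobs_def swap_placement_def)
    ultimately show thesis
      using * schedule_swap_placement[OF assms(2) *(1,2)] by (intro that[of ?q]) auto
  next
    case 3
    then obtain j m where *: "j \<in> J" "m \<in> M" "m \<noteq> snd (p j)"
      "fst (p j) = Suc (card J - load J p (snd (p j)))" "s = encode J M (shift_placement J p j m)"
      using starting_job_shift_encode_iff[OF assms(1,2)] by blast
    let ?q = "shift_placement J p j m"
    have "card (moved_jobs J p ?q) \<le> card {j}" "card (reassigned_jobs J p ?q) \<le> card {j}"
      by (intro card_mono; auto simp: moved_jobs_def reassigned_jobs_def shift_placement_def
          split: if_splits)+
    then show thesis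
      using * schedule_shift_placement[OF assms(1,2) *(1-4)] by (intro that[of ?q]) auto
  qed
qed

theorem proposition3:
  fixes J :: "'j set" and M :: "'m set"
    and x0 :: "('j, 'm) xvec" and y0 :: "('j, 'm) yvec"
  assumes "finite J" and "finite M"
    and "feasible J M (x0, y0)"
  shows "swap_shift_neighbourhood J M (x0, y0) = k_opt_neighbourhood J M 4 (x0, y0) \<and>
    (\<forall>x y. feasible J M (x, y) \<longrightarrow>
       ((x, y) \<in> swap_shift_neighbourhood J M (x0, y0) \<longleftrightarrow>
        local_branching_lhs J M (x0, y0) (x, y) \<le> 2))"
proof -
  obtain p where p: "schedule J M p" and p_enc: "(x0, y0) = encode J M p"
    using feasible_imp_schedule[OF assms] .
  have range: "q \<in> J \<rightarrow> slots J \<times> M" if "schedule J M q" for q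
    using that by (simp add: schedule_def)
  have feas: "feasible J M (encode J M q)" if "schedule J M q" for q
    using that feasible_encode_iff[OF assms(1,2) range] by blast
  let ?dist = "\<lambda>q. card (moved_jobs J p q) + card (reassigned_jobs J p q)"
  have lhs: "local_branching_lhs J M (x0, y0) (encode J M q) = int (?dist q)"
    if "schedule J M q" for q
    unfolding p_enc by (rule local_branching_lhs_encode[OF assms(1,2) range[OF p] range[OF that]])
  \<comment> \<open>The bound 4 on coordinates becomes 2 on jobs because each moved or reassigned
    job accounts for two flipped coordinates.\<close>
  have kopt: "encode J M q \<in> k_opt_neighbourhood J M 4 (x0, y0) \<longleftrightarrow> ?dist q \<le> 2"
    if q: "schedule J M q" for q
  proof -
    have "encode J M q \<in> k_opt_neighbourhood J M 4 (encode J M p) \<longleftrightarrow> ?dist q \<le> 2"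
      using feas[OF q] card_diff_position_vec[OF assms(1) range[OF p] range[OF q]]
        card_diff_machine_vec[OF assms(1) range[OF p] range[OF q]]
      by (auto simp: k_opt_neighbourhood_def encode_def)
    then show ?thesis
      by (simp add: p_enc)
  qed
  have nbh: "encode J M q \<in> swap_shift_neighbourhood J M (x0, y0) \<longleftrightarrow> ?dist q \<le> 2"
    if q: "schedule J M q" for q
  proof
    assume "encode J M q \<in> swap_shift_neighbourhood J M (x0, y0)"
    then obtain r where r: "schedule J M r" "encode J M q = encode J M r" "?dist r \<le> 2"
      using swap_shift_neighbourhoodD[OF assms(1) p] p_enc by metis
    \<comment> \<open>The placements \<open>r\<close> and \<open>q\<close> may differ outside
      \<open>J\<close>; \<open>kopt\<close> transfers the bound because its left side depends only
      on the common encoding.\<close>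
    then show "?dist q \<le> 2"
      using kopt q by metis
  next
    assume "?dist q \<le> 2"
    then show "encode J M q \<in> swap_shift_neighbourhood J M (x0, y0)"
      unfolding p_enc by (rule few_moves_cases[OF assms(1) p q])
  qed
  have "s \<in> swap_shift_neighbourhood J M (x0, y0) \<longleftrightarrow> s \<in> k_opt_neighbourhood J M 4 (x0, y0)" for s
  proof (cases "feasible J M s")
    case True
    then show ?thesis
      using feasible_imp_schedule[OF assms(1,2)] nbh kopt by metis
  next
    case False
    moreover have "s \<notin> swap_shift_neighbourhood J M (x0, y0)"
      using False feas swap_shift_neighbourhoodD[OF assms(1) p] p_enc by metis
    ultimately show ?thesis
      by (auto simp: k_opt_neighbourhood_def)
  qed
  moreover have "(x, y) \<in> swap_shift_neighbourhood J M (x0, y0) \<longleftrightarrow>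
      local_branching_lhs J M (x0, y0) (x, y) \<le> 2" if xy: "feasible J M (x, y)" for x y
  proof -
    obtain q where "schedule J M q" "(x, y) = encode J M q"
      using feasible_imp_schedule[OF assms(1,2) xy] .
    then show ?thesis
      using nbh lhs by auto
  qed
  ultimately show ?thesis
    by blast
qed

end
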